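(* Let $\mathcal{I}$ be an index coding (IC) problem over a finite field $\mathbb{F}_q$ with $L\times K$ fitting matrix $F_X$, and let $$G=[A_1|A_2|\cdots|A_T|P]$$ be an $r\times K$ index code for $\mathcal{I}$ of rank $r$, where each $A_i$ is an $r\times r$ matrix; let $\mathcal{I}_i$ be the set of column indices of $A_i$ in $G$ (the blocks $A_i$ need not occupy consecutive columns as displayed, but the sets $\mathcal{I}_1,\dots,\mathcal{I}_T$ are pairwise disjoint). Let $C$ be an $r\times r$ involutory permutation matrix such that $A_iC=CA_i$ for all $i\in\{1,\dots,T\}$. Let $B_X^X$ be the $L\times K$ $X$-fitting matrix obtained from $F_X$ by the following procedure: (1) for $j=1,\dots,T$, the $r$ columns of $F_X$ indexed by $\mathcal{I}_j$ are permuted among themselves by $\sigma_C$; (2) all elements in the $K-Tr$ columns of $F_X$ not in any $\mathcal{I}_j$ are replaced by $X$; (3) all the $1$s in the matrix obtained after performing operations (1) and (2) (the column permutations by $\sigma_C$ within each $\mathcal{I}_j$ and the replacement by $X$ of all entries in the columns not in any $\mathcal{I}_j$) are replaced by $X$s. Then $(G~~CG)$ is an index code for the extended IC problem $\mathcal{I}_{ext}$ with fitting matrix $$\begin{pmatrix}F_X & B_X^X\\ B_X^X & F_X\end{pmatrix}.$$ Furthermore, if $G$ is optimal for $\mathcal{I}$, then $(G~~CG)$ is an optimal code for $\mathcal{I}_{ext}$ and $\mathcal{I}_{ext}$ is a rank-invariant $2$-order extension of $\mathcal{I}$.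
   Context: Fix a finite field $\mathbb{F}_q$. A fitting matrix $F_X$ of size $L\times K$ ($L\ge K$) is a matrix with entries in the symbol set $\{0,1,X\}$ such that each row contains exactly one $1$ (its other entries being $0$s and $X$s), and for every column $k$ there is at least one row having its $1$ in position $k$. It defines an IC problem with $K$ messages, with symbols $x_1,\dots,x_K\in\mathbb{F}_q$, and $L$ receivers, one per row: the receiver of a row demands the message $k$ where the row has its $1$, and has as side-information exactly the message symbols at the positions where the row has an $X$. An $X$-fitting matrix is a matrix with all entries in $\{0,X\}$. A (scalar linear) index code of length $r$ for the problem is an $r\times K$ matrix $G$ over $\mathbb{F}_q$ such that, when $G\boldsymbol{x}$ is broadcast for $\boldsymbol{x}=(x_1,\dots,x_K)^T\in\mathbb{F}_q^K$, every receiver can recover its demanded symbol from $G\boldsymbol{x}$ and its side-information symbols (for all $\boldsymbol{x}$). The code is optimal if its length $r$ is the minimum possible among all such codes for the problem. $minrk(F_X)$ is the minimum rank over $\mathbb{F}_q$ of the matrices obtained from $F_X$ by replacing each $X$ by an arbitrary element of $\mathbb{F}_q$ (independently for each position; the $0$s and $1$s are kept). It is a known fact that the optimal length of a scalar linear index code equals $minrk(F_X)$. An IC problem $\mathcal{I}_{ext}$ with fitting matrix $F_{ext,X}$ is an extension of $\mathcal{I}$ (with $L\times K$ fitting matrix $F_X$) if $F_X$ is a submatrix of $F_{ext,X}$; it is a $2$-order extension if $F_{ext,X}$ is $2L\times 2K$. The extension is rank-invariant if the optimal code lengths are equal, i.e. $minrk(F_{ext,X})=minrk(F_X)$. An involutory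 permutation matrix is a permutation matrix $C$ with $C^2=I$ (hence $C=C^T$). $\sigma_C$ denotes the corresponding permutation of $\{1,\dots,r\}$: pre-multiplication by $C$ moves row $k$ to row $\sigma_C(k)$, and post-multiplication by $C$ moves column $k$ to column $\sigma_C(k)$. Permuting the columns indexed by $\mathcal{I}_j$ by $\sigma_C$ means: if the $p$-th column of $A_j$ is the column of $G$ with index $c_p\in\mathcal{I}_j$ ($p=1,\dots,r$), then the column of $F_X$ in position $c_p$ is moved to position $c_{\sigma_C(p)}$. *)

theory Defs
  imports "Jordan_Normal_Form.DL_Rank" "Jordan_Normal_Form.DL_Submatrix"
begin

text \<open>All row, column and block indices are 0-based: messages are \<open>0, \<dots>, K - 1\<close>, receivers are
  \<open>0, \<dots>, L - 1\<close>. An index coding problem is represented by its fitting matrix.\<close>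

datatype symb = Zero | One | X

definition fitting_matrix :: "nat \<Rightarrow> nat \<Rightarrow> symb mat \<Rightarrow> bool" where
  "fitting_matrix L K F \<longleftrightarrow> F \<in> carrier_mat L K \<and> K \<le> L \<and>
     (\<forall>i<L. \<exists>!k. k < K \<and> F $$ (i, k) = One) \<and>
     (\<forall>k<K. \<exists>i<L. F $$ (i, k) = One)"

definition X_fitting_matrix :: "nat \<Rightarrow> nat \<Rightarrow> symb mat \<Rightarrow> bool" where
  "X_fitting_matrix L K B \<longleftrightarrow> B \<in> carrier_mat L K \<and> (\<forall>i<L. \<forall>k<K. B $$ (i, k) \<in> {Zero, X})"


subsection \<open>Index codes\<close>

text \<open>What receiver \<open>i\<close> knows in advance: exactly the symbols at the \<open>X\<close> positions of its row.\<close>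

definition side_info :: "symb mat \<Rightarrow> nat \<Rightarrow> 'a vec \<Rightarrow> nat \<Rightarrow> 'a option" where
  "side_info F i x = (\<lambda>k. if k < dim_col F \<and> F $$ (i, k) = X then Some (x $ k) else None)"

text \<open>The decoders \<open>D\<close> are arbitrary functions; only the encoding is linear.\<close>

definition index_code :: "symb mat \<Rightarrow> 'a::field mat \<Rightarrow> bool" where
  "index_code F G \<longleftrightarrow> dim_col G = dim_col F \<and>
     (\<forall>i<dim_row F. \<forall>k<dim_col F. F $$ (i, k) = One \<longrightarrow>
        (\<exists>D :: 'a vec \<Rightarrow> (nat \<Rightarrow> 'a option) \<Rightarrow> 'a. \<forall>x\<in>carrier_vec (dim_col F).
           D (G *\<^sub>v x) (side_info F i x) = x $ k))"

definition optimal_index_code :: "symb mat \<Rightarrow> 'a::field mat \<Rightarrow> bool" where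
  "optimal_index_code F G \<longleftrightarrow> index_code F G \<and>
     (\<forall>G' :: 'a mat. index_code F G' \<longrightarrow> dim_row G \<le> dim_row G')"

definition optimal_length :: "'a::field itself \<Rightarrow> symb mat \<Rightarrow> nat" where
  "optimal_length _ F = (LEAST r. \<exists>G :: 'a mat. index_code F G \<and> dim_row G = r)"


subsection \<open>Minrank\<close>

definition completes :: "symb mat \<Rightarrow> 'a::field mat \<Rightarrow> bool" where
  "completes F M \<longleftrightarrow> M \<in> carrier_mat (dim_row F) (dim_col F) \<and>
     (\<forall>i<dim_row F. \<forall>k<dim_col F.
        (F $$ (i, k) = Zero \<longrightarrow> M $$ (i, k) = 0) \<and> (F $$ (i, k) = One \<longrightarrow> M $$ (i, k) = 1))"

definition minrk :: "'a::field itself \<Rightarrow> symb mat \<Rightarrow> nat" where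
  "minrk _ F = (LEAST n. \<exists>M :: 'a mat. completes F M \<and> vec_space.rank (dim_row F) M = n)"


subsection \<open>Extensions\<close>

definition ic_extension :: "symb mat \<Rightarrow> symb mat \<Rightarrow> bool" where
  "ic_extension F F' \<longleftrightarrow>
     fitting_matrix (dim_row F) (dim_col F) F \<and> fitting_matrix (dim_row F') (dim_col F') F' \<and>
     (\<exists>I J. submatrix F' I J = F)"

definition two_order_extension :: "symb mat \<Rightarrow> symb mat \<Rightarrow> bool" where
  "two_order_extension F F' \<longleftrightarrow> ic_extension F F' \<and>
     F' \<in> carrier_mat (2 * dim_row F) (2 * dim_col F)"

text \<open>Equality of optimal lengths is the same as equality of minranks, since the optimal scalar linear
  code length is the minrank. Both are demanded here, so that this definition does not depend on
  that fact.\<close>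

definition rank_invariant :: "'a::field itself \<Rightarrow> symb mat \<Rightarrow> symb mat \<Rightarrow> bool" where
  "rank_invariant q F F' \<longleftrightarrow>
     optimal_length q F' = optimal_length q F \<and> minrk q F' = minrk q F"


subsection \<open>Permutation matrices\<close>

text \<open>\<open>perm_matrix r \<pi>\<close> moves row \<open>k\<close> to row \<open>\<pi> k\<close> when multiplied from the left. Multiplied from the
  right it moves column \<open>\<pi> k\<close> to column \<open>k\<close>, which for an involution \<open>\<pi>\<close> is the same as
  moving column \<open>k\<close> to column \<open>\<pi> k\<close>.\<close>

definition perm_matrix :: "nat \<Rightarrow> (nat \<Rightarrow> nat) \<Rightarrow> 'a::field mat" where
  "perm_matrix r \<pi> = mat r r (\<lambda>(i, k). if i = \<pi> k then 1 else 0)"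

definition involutory_permutation_matrix :: "nat \<Rightarrow> 'a::field mat \<Rightarrow> bool" where
  "involutory_permutation_matrix r C \<longleftrightarrow>
     (\<exists>\<pi>. \<pi> permutes {..<r} \<and> C = perm_matrix r \<pi>) \<and> C * C = 1\<^sub>m r"

definition perm_of :: "nat \<Rightarrow> 'a::field mat \<Rightarrow> nat \<Rightarrow> nat" where
  "perm_of r C = (THE \<pi>. \<pi> permutes {..<r} \<and> C = perm_matrix r \<pi>)"

lemma perm_of_perm_matrix:
  assumes "\<pi> permutes {..<r}"
  shows "perm_of r (perm_matrix r \<pi> :: 'a::field mat) = \<pi>"
  unfolding perm_of_def
proof (rule the_equality)
  fix \<tau> assume t: "\<tau> permutes {..<r} \<and> perm_matrix r \<pi> = (perm_matrix r \<tau> :: 'a mat)"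
  show "\<tau> = \<pi>"
  proof
    fix k
    show "\<tau> k = \<pi> k"
    proof (cases "k < r")
      case True
      then have "\<pi> k < r" using permutes_in_image[OF assms, of k] by simp
      then have "(perm_matrix r \<pi> :: 'a mat) $$ (\<pi> k, k) = 1"
        and "(perm_matrix r \<tau> :: 'a mat) $$ (\<pi> k, k) = (if \<pi> k = \<tau> k then 1 else 0)"
        using True by (simp_all add: perm_matrix_def)
      then show ?thesis using t by (metis zero_neq_one)
    next
      case False
      then show ?thesis using permutes_not_in[OF assms, of k] permutes_not_in[OF t[THEN conjunct1], of k] by simp
    qed
  qed
qed (use assms in simp)


subsection \<open>The procedure producing the X-fitting matrix\<close>

text \<open>A block of \<open>r\<close> columns is given by an injection \<open>c\<close> on \<open>{..<r}\<close>, \<open>c p\<close> being the position of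
  its \<open>p\<close>-th column. The column in position \<open>c p\<close> is moved to position \<open>c (\<sigma> p)\<close>.\<close>

definition permute_block :: "nat \<Rightarrow> (nat \<Rightarrow> nat) \<Rightarrow> (nat \<Rightarrow> nat) \<Rightarrow> 'b mat \<Rightarrow> 'b mat" where
  "permute_block r \<sigma> c M = mat (dim_row M) (dim_col M) (\<lambda>(i, k).
     if \<exists>p<r. k = c (\<sigma> p) then M $$ (i, c (THE p. p < r \<and> k = c (\<sigma> p))) else M $$ (i, k))"

definition permute_blocks ::
  "nat \<Rightarrow> nat \<Rightarrow> (nat \<Rightarrow> nat) \<Rightarrow> (nat \<Rightarrow> nat \<Rightarrow> nat) \<Rightarrow> 'b mat \<Rightarrow> 'b mat" where
  "permute_blocks T r \<sigma> c M = fold (\<lambda>j. permute_block r \<sigma> (c j)) [0..<T] M"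

definition X_outside :: "nat set \<Rightarrow> symb mat \<Rightarrow> symb mat" where
  "X_outside S M = mat (dim_row M) (dim_col M) (\<lambda>(i, k). if k \<in> S then M $$ (i, k) else X)"

definition ones_to_X :: "symb mat \<Rightarrow> symb mat" where
  "ones_to_X = map_mat (\<lambda>s. if s = One then X else s)"

definition BXX :: "nat \<Rightarrow> nat \<Rightarrow> (nat \<Rightarrow> nat) \<Rightarrow> (nat \<Rightarrow> nat \<Rightarrow> nat) \<Rightarrow> symb mat \<Rightarrow> symb mat" where
  "BXX T r \<sigma> c F =
     ones_to_X (X_outside (\<Union>j<T. c j ` {..<r}) (permute_blocks T r \<sigma> c F))"

lemma permute_blocks_carrier:
  "M \<in> carrier_mat L K \<Longrightarrow> permute_blocks T r \<sigma> c M \<in> carrier_mat L K"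
  unfolding permute_blocks_def by (induction T) (auto simp: permute_block_def)

lemma X_fitting_matrix_BXX:
  assumes "F \<in> carrier_mat L K"
  shows "X_fitting_matrix L K (BXX T r \<sigma> c F)"
proof -
  have "s = Zero \<or> s = X" if "s \<noteq> One" for s using that by (cases s) auto
  then show ?thesis
    using permute_blocks_carrier[OF assms, of T r \<sigma> c]
    by (auto simp: X_fitting_matrix_def BXX_def ones_to_X_def X_outside_def)
qed

definition ext_matrix :: "symb mat \<Rightarrow> symb mat \<Rightarrow> symb mat" where
  "ext_matrix F B = four_block_mat F B B F"

definition append_cols :: "'a::zero mat \<Rightarrow> 'a mat \<Rightarrow> 'a mat" where
  "append_cols A B = four_block_mat A B (0\<^sub>m 0 (dim_col A)) (0\<^sub>m 0 (dim_col B))"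

end

theory Submission
  imports Defs
begin

text \<open>By duality, \<open>G\<close> is an index code for \<open>F\<close> iff \<open>W * G\<close> completes \<open>F\<close> for some decoding matrix
  \<open>W\<close>; together with rank factorization this identifies the minrank with the optimal length.
  As \<open>C\<close> commutes with every block, \<open>W * (C * G)\<close> has inside each block the columns of \<open>W * G\<close>
  permuted by \<open>C\<close>, so it completes \<open>B\<close>. Since \<open>C * C = 1\<close>, the rows of \<open>W\<close> and of \<open>W * C\<close>
  decode \<open>(G, C * G)\<close> for the extended problem. Conversely, the first \<open>K\<close> columns of a code for
  the extended problem form a code for \<open>F\<close> of the same length, so the optimal length cannot drop.\<close>

section \<open>Index codes and completions\<close>

text \<open>A linear functional that vanishes on a common kernel factors through the functionals
  defining it. The induction restricts to the kernel of \<open>f n\<close>, and one vector outside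
  that kernel fixes the last coefficient. Closure and linearity are phrased through
  \<open>x - t \<cdot>\<^sub>v y\<close> alone because the induction forms no other combination, and
  these conditions pass to the kernel.\<close>

lemma functional_combination:
  fixes V :: "'a::field vec set" and f :: "nat \<Rightarrow> 'a vec \<Rightarrow> 'a" and \<phi> :: "'a vec \<Rightarrow> 'a"
  assumes "\<And>x y t. x \<in> V \<Longrightarrow> y \<in> V \<Longrightarrow> x - t \<cdot>\<^sub>v y \<in> V"
    and "\<And>i x y t. x \<in> V \<Longrightarrow> y \<in> V \<Longrightarrow> f i (x - t \<cdot>\<^sub>v y) = f i x - t * f i y"
    and "\<And>x y t. x \<in> V \<Longrightarrow> y \<in> V \<Longrightarrow> \<phi> (x - t \<cdot>\<^sub>v y) = \<phi> x - t * \<phi> y"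
    and "\<And>x. x \<in> V \<Longrightarrow> (\<And>i. i < n \<Longrightarrow> f i x = 0) \<Longrightarrow> \<phi> x = 0"
  shows "\<exists>a. \<forall>x\<in>V. \<phi> x = (\<Sum>i<n. a i * f i x)"
  using assms
proof (induction n arbitrary: V)
  case 0
  then show ?case by simp
next
  case (Suc n)
  note V = Suc.prems(1) and f = Suc.prems(2) and phi = Suc.prems(3)
  define U where "U = {x \<in> V. f n x = 0}"
  have "\<exists>a. \<forall>x\<in>U. \<phi> x = (\<Sum>i<n. a i * f i x)"
  proof (rule Suc.IH)
    show "x - t \<cdot>\<^sub>v y \<in> U" if "x \<in> U" "y \<in> U" for x y t
      using that V f by (simp add: U_def)
    show "\<phi> x = 0" if "x \<in> U" "\<And>i. i < n \<Longrightarrow> f i x = 0" for x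
      using that Suc.prems(4)[of x] by (auto simp: U_def less_Suc_eq)
  qed (use f phi in \<open>simp_all add: U_def\<close>)
  then obtain a where a: "\<And>x. x \<in> U \<Longrightarrow> \<phi> x = (\<Sum>i<n. a i * f i x)" by blast
  show ?case
  proof (cases "\<forall>x\<in>V. f n x = 0")
    case True
    \<comment> \<open>Here \<open>f n\<close> vanishes on all of \<open>V\<close>, so whatever
      \<open>a n\<close> is, it does not affect the sum.\<close>
    then show ?thesis using a by (intro exI[of _ a]) (auto simp: U_def)
  next
    case False
    then obtain v where v: "v \<in> V" "f n v \<noteq> 0" by blast
    \<comment> \<open>The coefficient forced by evaluating the desired identity at
      \<open>v\<close>.\<close>
    define b where "b = (\<phi> v - (\<Sum>i<n. a i * f i v)) / f n v"
    have "\<phi> x = (\<Sum>i<n. a i * f i x) + b * f n x" if x: "x \<in> V" for x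
    proof -
      \<comment> \<open>Chosen so that \<open>f n\<close> vanishes at
        \<open>x - t \<cdot>\<^sub>v v\<close>, which puts this vector in \<open>U\<close>.\<close>
      define t where "t = f n x / f n v"
      have "x - t \<cdot>\<^sub>v v \<in> U" using x v V f by (simp add: U_def t_def)
      then have "\<phi> x - t * \<phi> v = (\<Sum>i<n. a i * (f i x - t * f i v))"
        using a[of "x - t \<cdot>\<^sub>v v"] f[OF x v(1)] phi[OF x v(1)] by simp
      also have "\<dots> = (\<Sum>i<n. a i * f i x) - t * (\<Sum>i<n. a i * f i v)"
        by (simp add: right_diff_distrib sum_subtractf sum_distrib_left mult.left_commute)
      finally have "\<phi> x = (\<Sum>i<n. a i * f i x) + t * (\<phi> v - (\<Sum>i<n. a i * f i v))"
        by (simp add: algebra_simps)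
      then show ?thesis by (simp add: b_def t_def)
    qed
    then show ?thesis by (intro exI[of _ "a(n := b)"]) simp
  qed
qed

lemma fitting_matrix_One_unique:
  assumes "fitting_matrix L K F" "i < L" "k < K" "m < K" "F $$ (i, k) = One" "F $$ (i, m) = One"
  shows "m = k"
  using assms by (auto simp: fitting_matrix_def)

text \<open>Apply the decoder to the message \<open>x\<close> and to the message \<open>0\<close>.\<close>

lemma index_code_kernel:
  fixes G :: "'a::field mat"
  assumes "index_code F G" and "i < dim_row F" "k < dim_col F" "F $$ (i, k) = One"
    and x: "x \<in> carrier_vec (dim_col F)" "G *\<^sub>v x = 0\<^sub>v (dim_row G)"
    and X: "\<And>m. m < dim_col F \<Longrightarrow> F $$ (i, m) = X \<Longrightarrow> x $ m = 0"
  shows "x $ k = 0"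
proof -
  have dim: "dim_col G = dim_col F" using assms(1) by (simp add: index_code_def)
  obtain D :: "'a vec \<Rightarrow> (nat \<Rightarrow> 'a option) \<Rightarrow> 'a" where
    D: "\<And>x. x \<in> carrier_vec (dim_col F) \<Longrightarrow> D (G *\<^sub>v x) (side_info F i x) = x $ k"
    using assms(1-4) unfolding index_code_def by metis
  have "side_info F i x = side_info F i (0\<^sub>v (dim_col F))"
    using X by (auto simp: side_info_def)
  moreover have "G *\<^sub>v 0\<^sub>v (dim_col F) = 0\<^sub>v (dim_row G)"
    using dim by (intro eq_vecI) (auto simp: scalar_prod_def)
  ultimately show ?thesis using D[OF x(1)] D[of "0\<^sub>v (dim_col F)"] x(2) assms(3) by simp
qed

text \<open>Row \<open>i\<close> of \<open>W\<close> decodes for receiver \<open>i\<close>: its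
  product with the received word is the demanded symbol plus a combination of symbols at
  \<open>X\<close> positions, which the receiver knows and subtracts.\<close>

lemma completes_imp_index_code:
  fixes G :: "'a::field mat"
  assumes F: "fitting_matrix L K F" and G: "G \<in> carrier_mat r K" and W: "W \<in> carrier_mat L r"
    and M: "completes F (W * G)"
  shows "index_code F G"
proof -
  have FC: "F \<in> carrier_mat L K" using F by (simp add: fitting_matrix_def)
  have "\<exists>D. \<forall>x\<in>carrier_vec K. D (G *\<^sub>v x) (side_info F i x) = x $ k"
    if ik: "i < L" "k < K" "F $$ (i, k) = One" for i k
  proof -
    define D where "D = (\<lambda>y s. row W i \<bullet> y -
      (\<Sum>m\<in>{0..<K} - {k}. case s m of None \<Rightarrow> 0 | Some v \<Rightarrow> (W * G) $$ (i, m) * v))"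
    have "D (G *\<^sub>v x) (side_info F i x) = x $ k" if x: "x \<in> carrier_vec K" for x
    proof -
      have "row W i \<bullet> (G *\<^sub>v x) = ((W * G) *\<^sub>v x) $ i"
        using assoc_mult_mat_vec[OF W G x] W ik by simp
      also have "\<dots> = (\<Sum>m\<in>{0..<K}. (W * G) $$ (i, m) * x $ m)"
      proof -
        have "(P *\<^sub>v x) $ i = (\<Sum>m\<in>{0..<K}. P $$ (i, m) * x $ m)" if "P \<in> carrier_mat L K" for P
          using that x ik by (simp add: scalar_prod_def)
        then show ?thesis using mult_carrier_mat[OF W G] by blast
      qed
      also have "\<dots> = (W * G) $$ (i, k) * x $ k + (\<Sum>m\<in>{0..<K} - {k}. (W * G) $$ (i, m) * x $ m)"
        using ik by (subst sum.remove[of _ k]) auto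
      also have "(W * G) $$ (i, k) = 1"
        using M ik FC by (simp add: completes_def)
      also have "(\<Sum>m\<in>{0..<K} - {k}. (W * G) $$ (i, m) * x $ m) =
        (\<Sum>m\<in>{0..<K} - {k}. case side_info F i x m of None \<Rightarrow> 0 | Some v \<Rightarrow> (W * G) $$ (i, m) * v)"
      \<comment> \<open>Away from \<open>k\<close> the row contains only \<open>Zero\<close> and
        \<open>X\<close>. At a \<open>Zero\<close> the default 0 for \<open>None\<close> is right,
        since the entry of \<open>W * G\<close> vanishes there.\<close>
      proof (rule sum.cong[OF refl])
        fix m assume m: "m \<in> {0..<K} - {k}"
        then have "F $$ (i, m) \<noteq> One" using fitting_matrix_One_unique[OF F ik(1,2) _ ik(3), of m] by auto
        then show "(W * G) $$ (i, m) * x $ m =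
          (case side_info F i x m of None \<Rightarrow> 0 | Some v \<Rightarrow> (W * G) $$ (i, m) * v)"
          using m M ik FC by (cases "F $$ (i, m)") (auto simp: side_info_def completes_def)
      qed
      finally show ?thesis by (simp add: D_def)
    qed
    then show ?thesis by blast
  qed
  then show ?thesis using FC G by (simp add: index_code_def)
qed

text \<open>Decoders may be nonlinear, so linearity is recovered from the kernel property: among
  messages with zero side information, those encoded to 0 have demanded symbol 0. Hence this symbol
  is a combination of the coordinates of \<open>G *\<^sub>v x\<close>, and the coefficients form one
  row of \<open>W\<close>.\<close>

lemma index_code_imp_completes:
  fixes G :: "'a::field mat"
  assumes F: "fitting_matrix L K F" and G: "G \<in> carrier_mat r K" and code: "index_code F G"
  shows "\<exists>W\<in>carrier_mat L r. completes F (W * G)"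
proof -
  have FC: "F \<in> carrier_mat L K" using F by (simp add: fitting_matrix_def)
  \<comment> \<open>\<open>good i a\<close> says that \<open>a\<close> can serve as row
    \<open>i\<close> of \<open>W\<close>.\<close>
  define good where "good i a \<longleftrightarrow> (\<forall>m<K. (F $$ (i, m) = Zero \<longrightarrow> (\<Sum>l<r. a l * G $$ (l, m)) = 0) \<and>
      (F $$ (i, m) = One \<longrightarrow> (\<Sum>l<r. a l * G $$ (l, m)) = 1))" for i a
  have "\<exists>a. good i a" if i: "i < L" for i
  proof -
    obtain k where k: "k < K" "F $$ (i, k) = One"
      using F i by (auto simp: fitting_matrix_def)
    define V where "V = {x \<in> carrier_vec K. \<forall>m<K. F $$ (i, m) = X \<longrightarrow> (x $ m :: 'a) = 0}"
    have "\<exists>a. \<forall>x\<in>V. x $ k = (\<Sum>l<r. a l * (row G l \<bullet> x))"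
    proof (rule functional_combination)
      show "x - t \<cdot>\<^sub>v y \<in> V" if "x \<in> V" "y \<in> V" for x y t
        using that by (auto simp: V_def)
      show "row G l \<bullet> (x - t \<cdot>\<^sub>v y) = row G l \<bullet> x - t * (row G l \<bullet> y)"
        if "x \<in> V" "y \<in> V" for l x y t
        using that G by (subst scalar_prod_minus_distrib[of _ K]) (auto simp: V_def)
      show "(x - t \<cdot>\<^sub>v y) $ k = x $ k - t * y $ k" if "x \<in> V" "y \<in> V" for x y t
        using that k by (auto simp: V_def)
      show "x $ k = 0" if x: "x \<in> V" "\<And>l. l < r \<Longrightarrow> row G l \<bullet> x = 0" for x
      proof (rule index_code_kernel[OF code])
        show "G *\<^sub>v x = 0\<^sub>v (dim_row G)" using x G by (intro eq_vecI) auto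
      qed (use x i k FC in \<open>auto simp: V_def\<close>)
    qed
    then obtain a where a: "\<And>x. x \<in> V \<Longrightarrow> x $ k = (\<Sum>l<r. a l * (row G l \<bullet> x))" by blast
    have "(\<Sum>l<r. a l * G $$ (l, m)) = (if m = k then 1 else 0)" if m: "m < K" "F $$ (i, m) \<noteq> X" for m
    proof -
      \<comment> \<open>Unit vectors at positions without an \<open>X\<close> lie in
        \<open>V\<close>; evaluating the combination at them reads off the constrained entries of
        the row.\<close>
      have "unit_vec K m \<in> V" using m by (auto simp: V_def unit_vec_def)
      from a[OF this] have "unit_vec K m $ k = (\<Sum>l<r. a l * G $$ (l, m))" using m G by simp
      then show ?thesis using m k by (auto simp: unit_vec_def)
    qed
    moreover have "F $$ (i, m) \<noteq> One" if "m < K" "m \<noteq> k" for m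
      using fitting_matrix_One_unique[OF F i k(1) that(1) k(2)] that(2) by blast
    ultimately have "good i a" using k(2) by (auto simp: good_def)
    then show ?thesis by blast
  qed
  then obtain a where a: "\<And>i. i < L \<Longrightarrow> good i (a i)" by metis
  define W where "W = mat L r (\<lambda>(i, l). a i l)"
  have "(W * G) $$ (i, m) = (\<Sum>l<r. a i l * G $$ (l, m))" if "i < L" "m < K" for i m
    using that G by (simp add: W_def scalar_prod_def atLeast0LessThan)
  moreover have W: "W \<in> carrier_mat L r" by (simp add: W_def)
  ultimately have "completes F (W * G)"
    using a FC G by (simp add: completes_def good_def del: index_mult_mat(1))
  then show ?thesis using W by blast
qed

section \<open>Minimal rank and optimal length\<close>

lemma (in vec_space) mult_mat_vec_in_span_cols:
  assumes W: "W \<in> carrier_mat n r" and v: "v \<in> carrier_vec r"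
  shows "W *\<^sub>v v \<in> span (set (cols W))"
proof -
  have cW: "set (cols W) \<subseteq> carrier_vec n" using W cols_dim by blast
  have "lincomb_list (\<lambda>i. v $ i) (cols W) = mat_of_cols n (cols W) *\<^sub>v vec (length (cols W)) (\<lambda>i. v $ i)"
    using cW by (intro lincomb_list_as_mat_mult) auto
  also have "\<dots> = W *\<^sub>v v"
    using W v by (metis carrier_matD carrier_vecD cols_length dim_vec eq_vecI index_vec mat_of_cols_cols)
  finally have "W *\<^sub>v v \<in> span_list (cols W)" by (metis in_span_listI)
  then show ?thesis using span_list_as_span[OF cW] by simp
qed

text \<open>The columns of \<open>W * G\<close> lie in the column space of \<open>W\<close>, whose
  dimension is at most \<open>r\<close>.\<close>

lemma (in vec_space) rank_mult_le:
  assumes W: "W \<in> carrier_mat n r" and G: "G \<in> carrier_mat r k"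
  shows "rank (W * G) \<le> r"
proof -
  have cW: "set (cols W) \<subseteq> carrier_vec n" using W cols_dim by blast
  have "set (cols (W * G)) \<subseteq> span (set (cols W))"
  proof
    fix x assume "x \<in> set (cols (W * G))"
    then obtain j where j: "j < k" "x = col (W * G) j"
      using W G unfolding cols_def by auto
    then have "x = W *\<^sub>v col G j" using col_mult2[OF W G] by blast
    then show "x \<in> span (set (cols W))"
      using mult_mat_vec_in_span_cols[OF W col_carrier_vec[OF j(1) G]] by simp
  qed
  then have sub: "span (set (cols (W * G))) \<subseteq> span (set (cols W))" by (rule span_subsetI[OF cW])
  have vsW: "vectorspace class_ring (vs (span (set (cols W))))"
    and sp: "VectorSpace.subspace class_ring (span (set (cols W))) V"
    using cW span_is_subspace subspace_is_vs by auto
  have "set (cols (W * G)) \<subseteq> carrier_vec n" using W G cols_dim[of "W * G"] by auto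
  then have "VectorSpace.subspace class_ring (span (set (cols (W * G)))) V"
    using span_is_subspace by simp
  \<comment> \<open>Dimensions are compared inside the column space of \<open>W\<close>, so the
    smaller span has to be a subspace of that space and not only of the full one.\<close>
  then have "VectorSpace.subspace class_ring (span (set (cols (W * G)))) (vs (span (set (cols W))))"
    using nested_subspaces[OF sp _ sub] by simp
  from vectorspace.subspace_dim[OF vsW this fin_dim_span_cols[OF W]]
  have "rank (W * G) \<le> rank W"
    using fin_dim_span_cols[OF mult_carrier_mat[OF W G]] by (simp add: rank_def)
  also have "\<dots> \<le> r" by (rule rank_le_nc[OF W])
  finally show ?thesis .
qed

text \<open>A maximal independent set of columns of \<open>M\<close> has \<open>rank M\<close>
  elements. These become the columns of \<open>W\<close>, and the coordinates of each column of
  \<open>M\<close> in them become a column of \<open>G\<close>.\<close>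

lemma (in vec_space) rank_factorization:
  assumes M: "M \<in> carrier_mat n k"
  shows "\<exists>W\<in>carrier_mat n (rank M). \<exists>G\<in>carrier_mat (rank M) k. M = W * G"
proof -
  let ?P = "\<lambda>T. T \<subseteq> set (cols M) \<and> lin_indpt T"
  have "lin_indpt {}" by (simp add: lin_dep_def)
  then obtain S where S: "finite S" "maximal S ?P"
    using maximal_exists_superset[of "set (cols M)" ?P "{}"] by auto
  have cM: "set (cols M) \<subseteq> carrier_vec n" using M cols_dim by blast
  have SM: "S \<subseteq> set (cols M)" "lin_indpt S" using S(2) by (auto simp: maximal_def)
  obtain ss where ss: "set ss = S" "distinct ss" using S(1) finite_distinct_list by blast
  have len: "length ss = rank M"
    using rank_card_indpt[OF M S(2)] ss distinct_card by metis
  have ssc: "set ss \<subseteq> carrier_vec n" using SM cM ss by blast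
  have "\<exists>g. col M j = lincomb_list g ss" if j: "j < k" for j
  proof -
    have jM: "col M j \<in> set (cols M)" using j M by (simp add: cols_def)
    \<comment> \<open>A column outside the span could be adjoined to \<open>S\<close>, against
      maximality.\<close>
    have "col M j \<in> span S"
    proof (rule ccontr)
      assume no: "col M j \<notin> span S"
      moreover from this have "col M j \<notin> S" using span_mem ssc ss by blast
      ultimately have "lin_indpt (insert (col M j) S)"
        using lin_dep_iff_in_span[of S "col M j"] SM cM jM by auto
      then have "insert (col M j) S = S" using S(2) jM SM by (auto simp: maximal_def)
      then show False using \<open>col M j \<notin> S\<close> by blast
    qed
    then have "col M j \<in> span_list ss" using span_list_as_span[OF ssc] ss by simp
    then show ?thesis by (meson in_span_listE)
  qed
  then obtain g where g: "\<And>j. j < k \<Longrightarrow> col M j = lincomb_list (g j) ss" by metis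
  define W where "W = mat_of_cols n ss"
  define G where "G = mat (rank M) k (\<lambda>(l, j). g j l)"
  have WG: "W \<in> carrier_mat n (rank M)" "G \<in> carrier_mat (rank M) k"
    using len by (auto simp: W_def G_def)
  have "col M j = col (W * G) j" if j: "j < k" for j
  proof -
    have "col G j = vec (length ss) (g j)" using j len by (intro eq_vecI) (auto simp: G_def)
    then show ?thesis
      using g[OF j] lincomb_list_as_mat_mult[of ss "g j"] ssc col_mult2[OF WG j]
      by (auto simp: W_def subset_iff)
  qed
  then have "M = W * G" using M WG by (intro mat_col_eqI) auto
  then show ?thesis using WG by blast
qed

text \<open>A shortest code yields a completion \<open>W * G\<close> whose rank is at most its
  length; conversely, factoring a completion of least rank yields a code whose length is that
  rank.\<close>

lemma minrk_eq_optimal_length: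
  assumes F: "fitting_matrix L K F"
  shows "minrk TYPE('a::field) F = optimal_length TYPE('a) F"
proof -
  have FC: "F \<in> carrier_mat L K" using F by (simp add: fitting_matrix_def)
  \<comment> \<open>Sending all messages uncoded is a code, so the \<open>LEAST\<close> in
    \<open>optimal_length\<close> is attained.\<close>
  have "index_code F (1\<^sub>m K :: 'a mat)"
    unfolding index_code_def using FC by (auto intro!: exI[of _ "\<lambda>y _. y $ k" for k])
  then have "\<exists>G :: 'a mat. index_code F G \<and> dim_row G = optimal_length TYPE('a) F"
    unfolding optimal_length_def
    by (intro LeastI_ex[where P = "\<lambda>r. \<exists>G :: 'a mat. index_code F G \<and> dim_row G = r"]) blast
  then obtain G :: "'a mat" where G: "index_code F G" "dim_row G = optimal_length TYPE('a) F" by blast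
  define r where "r = optimal_length TYPE('a) F"
  have Gc: "G \<in> carrier_mat r K" using G FC by (auto simp: r_def index_code_def)
  obtain W where W: "W \<in> carrier_mat L r" "completes F (W * G)"
    using index_code_imp_completes[OF F Gc G(1)] by blast
  have "minrk TYPE('a) F \<le> vec_space.rank L (W * G)"
    unfolding minrk_def using W FC by (intro Least_le) auto
  also have "\<dots> \<le> r" using vec_space.rank_mult_le[OF W(1) Gc] .
  finally have le: "minrk TYPE('a) F \<le> r" .
  \<comment> \<open>The \<open>LEAST\<close> in \<open>minrk\<close> is attained because
    \<open>W * G\<close> is a completion.\<close>
  have "\<exists>M :: 'a mat. completes F M \<and> vec_space.rank L M = minrk TYPE('a) F"
    unfolding minrk_def using W FC
    by (simp, intro LeastI_ex[where P = "\<lambda>n. \<exists>M :: 'a mat. completes F M \<and> vec_space.rank L M = n"]) blast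
  then obtain M :: "'a mat" where M: "completes F M" "vec_space.rank L M = minrk TYPE('a) F" by blast
  then have Mc: "M \<in> carrier_mat L K" using FC by (simp add: completes_def)
  obtain W' N where N: "W' \<in> carrier_mat L (minrk TYPE('a) F)" "N \<in> carrier_mat (minrk TYPE('a) F) K" "M = W' * N"
    using vec_space.rank_factorization[OF Mc] M(2) by auto
  then have "index_code F N" using completes_imp_index_code[OF F N(2,1)] M by simp
  then have "r \<le> minrk TYPE('a) F"
    unfolding r_def optimal_length_def using N by (intro Least_le) auto
  then show ?thesis using le by (simp add: r_def)
qed

lemma optimal_index_code_length:
  fixes G :: "'a::field mat"
  assumes "optimal_index_code F G"
  shows "optimal_length TYPE('a) F = dim_row G"
  unfolding optimal_length_def
  using assms by (intro Least_equality) (auto simp: optimal_index_code_def)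

section \<open>Extensions\<close>

lemma ext_matrix_index:
  assumes "F \<in> carrier_mat L K" "B \<in> carrier_mat L K" "i < 2 * L" "k < 2 * K"
  shows "ext_matrix F B $$ (i, k) =
    (if i < L then if k < K then F $$ (i, k) else B $$ (i, k - K)
     else if k < K then B $$ (i - L, k) else F $$ (i - L, k - K))"
  using assms by (simp add: ext_matrix_def)

lemma ext_matrix_carrier:
  "F \<in> carrier_mat L K \<Longrightarrow> ext_matrix F B \<in> carrier_mat (2 * L) (2 * K)"
  unfolding ext_matrix_def carrier_mat_def by simp

text \<open>\<open>B\<close> has no \<open>One\<close>, so each row and each column of the extended
  matrix gets its ones from the single copy of \<open>F\<close> that it meets.\<close>

lemma fitting_matrix_ext_matrix:
  assumes F: "fitting_matrix L K F" and B: "X_fitting_matrix L K B"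
  shows "fitting_matrix (2 * L) (2 * K) (ext_matrix F B)"
proof -
  have FC: "F \<in> carrier_mat L K" and BC: "B \<in> carrier_mat L K"
    using F B by (simp_all add: fitting_matrix_def X_fitting_matrix_def)
  have no: "B $$ (i, k) \<noteq> One" if "i < L" "k < K" for i k
    using B that unfolding X_fitting_matrix_def by fastforce
  note E = ext_matrix_index[OF FC BC]
  have "\<exists>!k. k < 2 * K \<and> ext_matrix F B $$ (i, k) = One" if i: "i < 2 * L" for i
  proof (cases "i < L")
    case True
    then obtain k where k: "k < K" "F $$ (i, k) = One" using F by (auto simp: fitting_matrix_def)
    show ?thesis
    proof (rule ex1I[of _ k])
      fix m assume m: "m < 2 * K \<and> ext_matrix F B $$ (i, m) = One"
      have "m < K"
      proof (rule ccontr)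
        assume "\<not> m < K"
        then have "m - K < K" "B $$ (i, m - K) = One" using m True i E[of i m] by auto
        then show False using no True by blast
      qed
      then show "m = k" using m True i E[of i m] fitting_matrix_One_unique[OF F True k(1) _ k(2)] by simp
    qed (use k True i in \<open>simp add: E\<close>)
  next
    case False
    then have i': "i - L < L" using i by simp
    then obtain k where k: "k < K" "F $$ (i - L, k) = One" using F by (auto simp: fitting_matrix_def)
    show ?thesis
    proof (rule ex1I[of _ "k + K"])
      fix m assume m: "m < 2 * K \<and> ext_matrix F B $$ (i, m) = One"
      then have mK: "\<not> m < K" using False i i' no[of "i - L" m] by (auto simp: E split: if_splits)
      then have "m - K < K" "F $$ (i - L, m - K) = One" using m False i E[of i m] by auto
      then have "m - K = k" using fitting_matrix_One_unique[OF F i' k(1) _ k(2)] by blast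
      then show "m = k + K" using mK by simp
    qed (use k False i in \<open>simp add: E\<close>)
  qed
  moreover have "\<exists>i<2 * L. ext_matrix F B $$ (i, k) = One" if k: "k < 2 * K" for k
  proof (cases "k < K")
    case True
    then obtain i where "i < L" "F $$ (i, k) = One" using F by (auto simp: fitting_matrix_def)
    then show ?thesis using True k by (intro exI[of _ i]) (simp add: E)
  next
    case False
    then have "k - K < K" using k by simp
    then obtain i where "i < L" "F $$ (i, k - K) = One" using F unfolding fitting_matrix_def by blast
    then show ?thesis using False k by (intro exI[of _ "i + L"]) (simp add: E)
  qed
  ultimately show ?thesis
    using F ext_matrix_carrier[OF FC, of B] by (auto simp: fitting_matrix_def)
qed

lemma submatrix_ext_matrix:
  assumes "F \<in> carrier_mat L K" "B \<in> carrier_mat L K"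
  shows "submatrix (ext_matrix F B) {..<L} {..<K} = F"
proof (rule eq_matI)
  note E = ext_matrix_carrier[OF assms(1), of B]
  have c: "card {i. i < 2 * n \<and> i \<in> {..<n}} = n" for n :: nat
    by (rule trans[OF arg_cong[of _ "{..<n}" card]]) auto
  show d: "dim_row (submatrix (ext_matrix F B) {..<L} {..<K}) = dim_row F"
    "dim_col (submatrix (ext_matrix F B) {..<L} {..<K}) = dim_col F"
    using E assms c by (simp_all only: dim_submatrix carrier_matD)
  fix i k assume "i < dim_row F" "k < dim_col F"
  then have ik: "i < L" "k < K" using assms by auto
  \<comment> \<open>\<open>submatrix_index_card\<close> addresses an entry by the number of smaller
    selected indices; in an initial segment this number is the index itself.\<close>
  have less: "card {a \<in> {..<n}. a < m} = m" if "m < n" for m n :: nat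
    by (rule trans[OF arg_cong[of _ "{..<m}" card]]) (use that in auto)
  have "submatrix (ext_matrix F B) {..<L} {..<K} $$ (i, k) = ext_matrix F B $$ (i, k)"
    using submatrix_index_card[of i "ext_matrix F B" k "{..<L}" "{..<K}"] E ik less[of i L] less[of k K]
    by simp
  then show "submatrix (ext_matrix F B) {..<L} {..<K} $$ (i, k) = F $$ (i, k)"
    using ik by (simp add: ext_matrix_index[OF assms])
qed

lemma two_order_extension_ext_matrix:
  assumes F: "fitting_matrix L K F" and B: "X_fitting_matrix L K B"
  shows "two_order_extension F (ext_matrix F B)"
proof -
  have "F \<in> carrier_mat L K" "B \<in> carrier_mat L K"
    using F B by (simp_all add: fitting_matrix_def X_fitting_matrix_def)
  then show ?thesis
    using submatrix_ext_matrix[of F L K B] ext_matrix_carrier[of F L K B]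
      fitting_matrix_ext_matrix[OF F B] F
    by (auto simp: two_order_extension_def ic_extension_def)
qed

text \<open>The upper left block of \<open>W' * G'\<close> is the product of the first
  \<open>L\<close> rows of \<open>W'\<close> and the first \<open>K\<close> columns of
  \<open>G'\<close>, and it completes \<open>F\<close>. The inner dimension, which is the code
  length, is unchanged.\<close>

lemma index_code_ext_matrix_restrict:
  fixes G' :: "'a::field mat"
  assumes F: "fitting_matrix L K F" and B: "X_fitting_matrix L K B"
    and code: "index_code (ext_matrix F B) G'"
  shows "\<exists>G :: 'a mat. index_code F G \<and> dim_row G = dim_row G'"
proof -
  have FC: "F \<in> carrier_mat L K" and BC: "B \<in> carrier_mat L K"
    using F B by (simp_all add: fitting_matrix_def X_fitting_matrix_def)
  define r where "r = dim_row G'"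
  have G': "G' \<in> carrier_mat r (2 * K)"
    using code ext_matrix_carrier[OF FC, of B] by (auto simp: index_code_def r_def)
  obtain W' where W': "W' \<in> carrier_mat (2 * L) r" "completes (ext_matrix F B) (W' * G')"
    using index_code_imp_completes[OF fitting_matrix_ext_matrix[OF F B] G' code] by blast
  define W where "W = mat L r (\<lambda>(i, l). W' $$ (i, l))"
  define G where "G = mat r K (\<lambda>(l, k). G' $$ (l, k))"
  have WG: "W \<in> carrier_mat L r" "G \<in> carrier_mat r K" by (simp_all add: W_def G_def)
  have "(W * G) $$ (i, k) = (W' * G') $$ (i, k)" if "i < L" "k < K" for i k
    using that W'(1) G' by (auto simp: W_def G_def scalar_prod_def)
  then have "completes F (W * G)"
    using W'(2) WG FC ext_matrix_carrier[OF FC, of B]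
    by (auto simp: completes_def ext_matrix_index[OF FC BC])
  then show ?thesis using completes_imp_index_code[OF F WG(2,1)] WG(2) r_def by auto
qed

section \<open>The permuted matrix\<close>

text \<open>Injectivity of \<open>c\<close> on the block and of \<open>\<sigma>\<close> leaves
  \<open>p\<close> as the only candidate for the \<open>THE\<close> in
  \<open>permute_block\<close>.\<close>

lemma permute_block_image:
  assumes "i < dim_row M" "c ` {..<r} \<subseteq> {..<dim_col M}" "\<sigma> permutes {..<r}" "inj_on c {..<r}" "p < r"
  shows "permute_block r \<sigma> c M $$ (i, c (\<sigma> p)) = M $$ (i, c p)"
proof -
  have s: "\<sigma> q < r" if "q < r" for q using permutes_in_image[OF assms(3), of q] that by simp
  have "q = p" if "q < r" "c (\<sigma> p) = c (\<sigma> q)" for q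
    using inj_onD[OF assms(4) that(2)] s that(1) assms(5) permutes_inj[OF assms(3)]
    by (auto dest: injD)
  then have "(THE q. q < r \<and> c (\<sigma> p) = c (\<sigma> q)) = p"
    using assms(5) by (intro the_equality) blast+
  moreover have "c (\<sigma> p) < dim_col M" using assms(2) s[OF assms(5)] by auto
  ultimately show ?thesis using assms(1,5) by (auto simp: permute_block_def)
qed

lemma permute_block_outside:
  assumes "i < dim_row M" "k < dim_col M" "\<sigma> permutes {..<r}" "k \<notin> c ` {..<r}"
  shows "permute_block r \<sigma> c M $$ (i, k) = M $$ (i, k)"
proof -
  have "k \<noteq> c (\<sigma> p)" if "p < r" for p
    using permutes_in_image[OF assms(3), of p] that assms(4) by auto
  then show ?thesis using assms(1,2) by (auto simp: permute_block_def)
qed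

lemma permute_blocks_Suc:
  "permute_blocks (Suc T) r \<sigma> c M = permute_block r \<sigma> (c T) (permute_blocks T r \<sigma> c M)"
  by (simp add: permute_blocks_def)

lemma permute_blocks_outside:
  assumes M: "M \<in> carrier_mat L K" and "i < L" "k < K" "\<sigma> permutes {..<r}"
    and "\<And>j. j < T \<Longrightarrow> k \<notin> c j ` {..<r}"
  shows "permute_blocks T r \<sigma> c M $$ (i, k) = M $$ (i, k)"
  using assms(5)
proof (induction T)
  case 0
  then show ?case by (simp add: permute_blocks_def)
next
  case (Suc T)
  then show ?case
    using permute_blocks_carrier[OF M, of T r \<sigma> c] assms(2-4)
    by (simp add: permute_blocks_Suc permute_block_outside)
qed

text \<open>The blocks are disjoint, so when block \<open>T\<close> is permuted its columns are
  still those of \<open>M\<close>, and the columns of the earlier blocks stay where they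
  are.\<close>

lemma permute_blocks_image:
  assumes M: "M \<in> carrier_mat L K" and i: "i < L" and \<sigma>: "\<sigma> permutes {..<r}" and p: "p < r"
    and c: "\<And>j. j < T \<Longrightarrow> inj_on (c j) {..<r} \<and> c j ` {..<r} \<subseteq> {..<K}"
    and disj: "disjoint_family_on (\<lambda>j. c j ` {..<r}) {..<T}"
    and j: "j < T"
  shows "permute_blocks T r \<sigma> c M $$ (i, c j (\<sigma> p)) = M $$ (i, c j p)"
  using c disj j
proof (induction T)
  case 0
  then show ?case by simp
next
  case (Suc T)
  have sp: "\<sigma> p < r" using permutes_in_image[OF \<sigma>, of p] p by simp
  have sep: "c a q \<notin> c b ` {..<r}" if "a < Suc T" "b < Suc T" "a \<noteq> b" "q < r" for a b q
    using Suc.prems(2) that by (auto simp: disjoint_family_on_def)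
  note car = permute_blocks_carrier[OF M, of T r \<sigma> c]
  have bnd: "c a q < K" if "a < Suc T" "q < r" for a q using Suc.prems(1)[OF that(1)] that(2) by auto
  show ?case
  proof (cases "j = T")
    case True
    have "permute_blocks (Suc T) r \<sigma> c M $$ (i, c j (\<sigma> p)) = permute_blocks T r \<sigma> c M $$ (i, c T p)"
      unfolding permute_blocks_Suc True
      using car i \<sigma> p Suc.prems(1)[of T] by (intro permute_block_image) auto
    also have "\<dots> = M $$ (i, c T p)"
      using sep[of T _ p] bnd[of T p] p by (intro permute_blocks_outside[OF M i _ \<sigma>]) auto
    finally show ?thesis using True by simp
  next
    case False
    then have j: "j < T" using Suc.prems(3) by simp
    have "permute_blocks (Suc T) r \<sigma> c M $$ (i, c j (\<sigma> p)) = permute_blocks T r \<sigma> c M $$ (i, c j (\<sigma> p))"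
      unfolding permute_blocks_Suc
      using car i \<sigma> sp bnd[of j "\<sigma> p"] sep[of j T "\<sigma> p"] j by (intro permute_block_outside) auto
    also have "\<dots> = M $$ (i, c j p)"
      using Suc.prems(1,2) j by (intro Suc.IH) (auto simp: disjoint_family_on_def)
    finally show ?thesis .
  qed
qed

text \<open>Replacing entries by \<open>X\<close> creates no \<open>Zero\<close>, so every
  \<open>Zero\<close> of the result is one of \<open>F\<close> carried along by
  \<open>\<sigma>\<close> inside a block. Since the result has no \<open>One\<close>, these are the
  only entries that constrain a completion.\<close>

lemma BXX_Zero:
  assumes F: "F \<in> carrier_mat L K" and i: "i < L" and k: "k < K" and \<sigma>: "\<sigma> permutes {..<r}"
    and c: "\<And>j. j < T \<Longrightarrow> inj_on (c j) {..<r} \<and> c j ` {..<r} \<subseteq> {..<K}"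
    and disj: "disjoint_family_on (\<lambda>j. c j ` {..<r}) {..<T}"
    and Z: "BXX T r \<sigma> c F $$ (i, k) = Zero"
  shows "\<exists>j<T. \<exists>p<r. k = c j (\<sigma> p) \<and> F $$ (i, c j p) = Zero"
proof -
  have "k \<in> (\<Union>j<T. c j ` {..<r})" and Z': "permute_blocks T r \<sigma> c F $$ (i, k) = Zero"
    using Z i k permute_blocks_carrier[OF F, of T r \<sigma> c]
    by (auto simp: BXX_def ones_to_X_def X_outside_def split: if_splits)
  then obtain j q where j: "j < T" "q < r" "k = c j q" by auto
  then obtain p where p: "p < r" "q = \<sigma> p"
    using permutes_image[OF \<sigma>] by (metis imageE lessThan_iff)
  then have "F $$ (i, c j p) = Zero"
    using Z' permute_blocks_image[OF F i \<sigma> p(1) c disj j(1)] j(3) by simp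
  then show ?thesis using j p by blast
qed

section \<open>Involutory permutation matrices and their action on columns\<close>

lemma involutory_permutation_matrix_perm_of:
  fixes C :: "'a::field mat"
  assumes "involutory_permutation_matrix r C"
  shows "perm_of r C permutes {..<r} \<and> C = perm_matrix r (perm_of r C) \<and>
    (\<forall>p<r. perm_of r C (perm_of r C p) = p)"
proof -
  obtain \<sigma> where s: "\<sigma> permutes {..<r}" "C = perm_matrix r \<sigma>" and CC: "C * C = 1\<^sub>m r"
    using assms by (auto simp: involutory_permutation_matrix_def)
  have "\<sigma> (\<sigma> p) = p" if p: "p < r" for p
  proof (rule ccontr)
    assume no: "\<sigma> (\<sigma> p) \<noteq> p"
    have sp: "\<sigma> p < r" using permutes_in_image[OF s(1), of p] p by simp
    \<comment> \<open>A nonzero summand needs both \<open>l = \<sigma> p\<close> and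
      \<open>p = \<sigma> l\<close>, hence \<open>\<sigma> (\<sigma> p) = p\<close>.\<close>
    have "(C * C) $$ (p, p) = (\<Sum>l\<in>{0..<r}. (if p = \<sigma> l then 1 else 0) * (if l = \<sigma> p then 1 else 0))"
      using p by (simp add: s(2) perm_matrix_def scalar_prod_def)
    also have "\<dots> = 0" using no by (intro sum.neutral) auto
    finally show False using CC p by simp
  qed
  then show ?thesis using s perm_of_perm_matrix[OF s(1), where 'a='a] by simp
qed

lemma col_mult_perm_matrix:
  fixes M :: "'a::field mat"
  assumes M: "M \<in> carrier_mat n r" and \<sigma>: "\<sigma> permutes {..<r}" and p: "p < r"
  shows "col (M * perm_matrix r \<sigma>) p = col M (\<sigma> p)"
proof (rule eq_vecI)
  have sp: "\<sigma> p < r" using permutes_in_image[OF \<sigma>, of p] p by simp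
  fix i assume "i < dim_vec (col M (\<sigma> p))"
  then have i: "i < n" using M by simp
  have "(M * perm_matrix r \<sigma>) $$ (i, p) = (\<Sum>l\<in>{0..<r}. M $$ (i, l) * (if l = \<sigma> p then 1 else 0))"
    using M i p by (simp add: perm_matrix_def scalar_prod_def)
  also have "\<dots> = M $$ (i, \<sigma> p)" using sp by (simp add: if_distrib cong: if_cong)
  finally show "col (M * perm_matrix r \<sigma>) p $ i = col M (\<sigma> p) $ i"
    using M i p sp by (simp add: perm_matrix_def)
qed (use M in simp)

section \<open>The code formed by \<open>G\<close> and \<open>C * G\<close> for the extended
  problem\<close>

lemma index_code_append_cols:
  fixes G C :: "'a::field mat"
  assumes F: "fitting_matrix L K F" and B: "X_fitting_matrix L K B"
    and G: "G \<in> carrier_mat r K" and C: "C \<in> carrier_mat r r" "C * C = 1\<^sub>m r"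
    and W: "W \<in> carrier_mat L r" and WG: "completes F (W * G)" and WCG: "completes B (W * (C * G))"
  shows "index_code (ext_matrix F B) (append_cols G (C * G))"
proof -
  have FC: "F \<in> carrier_mat L K" and BC: "B \<in> carrier_mat L K"
    using F B by (simp_all add: fitting_matrix_def X_fitting_matrix_def)
  define H where "H = append_cols G (C * G)"
  have H: "H \<in> carrier_mat r (2 * K)" using G C by (auto simp: H_def append_cols_def)
  \<comment> \<open>\<open>W\<close> stacked on \<open>W * C\<close>. Multiplied by
    \<open>H\<close>, it has the blocks \<open>W * G\<close> and \<open>W * (C * G)\<close> above
    \<open>W * (C * G)\<close> and \<open>W * G\<close>, the last one because
    \<open>C * C = 1\<^sub>m r\<close>. This is the block pattern of
    \<open>ext_matrix F B\<close>.\<close>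
  define W2 where "W2 = mat (2 * L) r (\<lambda>(i, l). if i < L then W $$ (i, l) else (W * C) $$ (i - L, l))"
  have W2: "W2 \<in> carrier_mat (2 * L) r" by (simp add: W2_def)
  have colH: "col H k = (if k < K then col G k else col (C * G) (k - K))" if "k < 2 * K" for k
    using that G C by (intro eq_vecI) (auto simp: H_def append_cols_def)
  have rowW: "row W2 i = (if i < L then row W i else row (W * C) (i - L))" if "i < 2 * L" for i
    using that W C by (intro eq_vecI) (auto simp: W2_def)
  have "(W * C) * G = W * (C * G)" using W C G by simp
  moreover have "(W * C) * (C * G) = W * G"
  proof -
    have "C * (C * G) = G" using C G by (metis assoc_mult_mat left_mult_one_mat)
    then show ?thesis using assoc_mult_mat[OF W C(1) mult_carrier_mat[OF C(1) G]] by simp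
  qed
  ultimately have E: "(W2 * H) $$ (i, k) =
    (if i < L then if k < K then (W * G) $$ (i, k) else (W * (C * G)) $$ (i, k - K)
     else if k < K then (W * (C * G)) $$ (i - L, k) else (W * G) $$ (i - L, k - K))"
    if ik: "i < 2 * L" "k < 2 * K" for i k
  proof -
    note eqs = \<open>(W * C) * G = W * (C * G)\<close>[symmetric] \<open>(W * C) * (C * G) = W * G\<close>[symmetric]
    have W2H: "(W2 * H) $$ (i, k) = row W2 i \<bullet> col H k" using ik W2 H by simp
    have car: "W * C \<in> carrier_mat L r" "C * G \<in> carrier_mat r K" using W C G by auto
    show ?thesis
    proof (cases "i < L")
      case True
      then show ?thesis
        using ik W G W2H car by (cases "k < K") (simp_all add: rowW colH del: assoc_mult_mat)
    next
      case False
      then show ?thesis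
        using ik W G W2H car eqs
        by (cases "k < K") (simp_all add: rowW colH del: assoc_mult_mat)
    qed
  qed
  have "completes (ext_matrix F B) (W2 * H)"
    unfolding completes_def
    using WG WCG FC BC H W2 ext_matrix_carrier[OF FC, of B]
    by (auto simp: completes_def E ext_matrix_index[OF FC BC] simp del: index_mult_mat)
  then show ?thesis
    using completes_imp_index_code[OF fitting_matrix_ext_matrix[OF F B] H W2] by (simp add: H_def)
qed

theorem theorem3:
  fixes G C :: "'a :: {finite, field} mat"
    and A :: "nat \<Rightarrow> 'a mat"
    and F B F_ext :: "symb mat"
    and c :: "nat \<Rightarrow> nat \<Rightarrow> nat"
    and L K T r :: nat
  assumes "fitting_matrix L K F"
    and "G \<in> carrier_mat r K"
    and "index_code F G"
    and "vec_space.rank r G = r"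
    and "\<And>j. j < T \<Longrightarrow> A j \<in> carrier_mat r r"
    and "\<And>j. j < T \<Longrightarrow> inj_on (c j) {..<r} \<and> c j ` {..<r} \<subseteq> {..<K}"
    and "disjoint_family_on (\<lambda>j. c j ` {..<r}) {..<T}"
    and "\<And>j p. j < T \<Longrightarrow> p < r \<Longrightarrow> col (A j) p = col G (c j p)"
    and "involutory_permutation_matrix r C"
    and "\<And>j. j < T \<Longrightarrow> A j * C = C * A j"
    and "B = BXX T r (perm_of r C) c F"
    and "F_ext = ext_matrix F B"
  shows "X_fitting_matrix L K B \<and> two_order_extension F F_ext \<and>
    index_code F_ext (append_cols G (C * G)) \<and>
    (optimal_index_code F G \<longrightarrow>
       optimal_index_code F_ext (append_cols G (C * G)) \<and>
       two_order_extension F F_ext \<and> rank_invariant TYPE('a) F F_ext)"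
proof -
  have FC: "F \<in> carrier_mat L K" using assms(1) by (simp add: fitting_matrix_def)
  have B: "X_fitting_matrix L K B" using X_fitting_matrix_BXX[OF FC] assms(11) by simp
  then have BC: "B \<in> carrier_mat L K" by (simp add: X_fitting_matrix_def)
  define \<sigma> where "\<sigma> = perm_of r C"
  have \<sigma>: "\<sigma> permutes {..<r}" "C = perm_matrix r \<sigma>" "perm_of r C = \<sigma>"
    "\<And>p. p < r \<Longrightarrow> \<sigma> (\<sigma> p) = p"
    using involutory_permutation_matrix_perm_of[OF assms(9)] by (simp_all add: \<sigma>_def)
  have C: "C \<in> carrier_mat r r" "C * C = 1\<^sub>m r"
    using assms(9) \<sigma>(2) by (auto simp: perm_matrix_def involutory_permutation_matrix_def)
  obtain W where W: "W \<in> carrier_mat L r" "completes F (W * G)"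
    using index_code_imp_completes[OF assms(1-3)] by blast
  have CG: "C * G \<in> carrier_mat r K" using C assms(2) by simp
  \<comment> \<open>The commutation hypothesis enters here: on block \<open>j\<close>, left
    multiplication by \<open>C\<close> equals right multiplication by \<open>C\<close>, a
    permutation of the columns of \<open>A j\<close>. Right multiplication puts column
    \<open>\<sigma> (\<sigma> p)\<close> in position \<open>\<sigma> p\<close>, and this is column
    \<open>p\<close> by involutivity.\<close>
  have col: "col (C * G) (c j (\<sigma> p)) = col G (c j p)" if jp: "j < T" "p < r" for j p
  proof -
    have sp: "\<sigma> p < r" using permutes_in_image[OF \<sigma>(1), of p] jp(2) by simp
    have "c j (\<sigma> p) < K" using assms(6)[OF jp(1)] sp by auto
    then have "col (C * G) (c j (\<sigma> p)) = C *\<^sub>v col (A j) (\<sigma> p)"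
      using col_mult2[OF C(1) assms(2)] assms(8)[OF jp(1) sp] by simp
    also have "\<dots> = col (A j * C) (\<sigma> p)"
      using col_mult2[OF C(1) assms(5)[OF jp(1)] sp] assms(10)[OF jp(1)] by simp
    also have "\<dots> = col (A j) p"
      using col_mult_perm_matrix[OF assms(5)[OF jp(1)] \<sigma>(1) sp] \<sigma>(2,4) jp(2) by simp
    finally show ?thesis using assms(8)[OF jp] by simp
  qed
  have "completes B (W * (C * G))"
    unfolding completes_def
  proof (intro conjI allI impI)
    show "W * (C * G) \<in> carrier_mat (dim_row B) (dim_col B)" using W(1) CG BC by simp
    fix i k assume ik: "i < dim_row B" "k < dim_col B"
    then have i: "i < L" and k: "k < K" using BC by auto
    show "(W * (C * G)) $$ (i, k) = 0" if Z: "B $$ (i, k) = Zero"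
    proof -
      obtain j p where jp: "j < T" "p < r" "k = c j (\<sigma> p)" "F $$ (i, c j p) = Zero"
        using BXX_Zero[OF FC i k \<sigma>(1) assms(6,7)] Z assms(11) \<sigma>(3) by auto
      have "c j p < K" using assms(6)[OF jp(1)] jp(2) by auto
      \<comment> \<open>The columns of \<open>C * G\<close> move exactly as those of
        \<open>F\<close> did, so the entry is traced back to a position where \<open>F\<close> has a
        \<open>Zero\<close>.\<close>
      then have "(W * (C * G)) $$ (i, k) = (W * G) $$ (i, c j p)"
        using col[OF jp(1,2)] jp(3) i k W(1) CG assms(2) by simp
      also have "\<dots> = 0" using W(2) jp(4) i \<open>c j p < K\<close> FC by (simp add: completes_def)
      finally show ?thesis .
    qed
    \<comment> \<open>Vacuous: an X-fitting matrix contains no \<open>One\<close>.\<close>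
    show "(W * (C * G)) $$ (i, k) = 1" if "B $$ (i, k) = One"
      using that B i k unfolding X_fitting_matrix_def by fastforce
  qed
  then have code: "index_code F_ext (append_cols G (C * G))"
    using index_code_append_cols[OF assms(1) B assms(2) C W] assms(12) by simp
  have ext: "two_order_extension F F_ext"
    using two_order_extension_ext_matrix[OF assms(1) B] assms(12) by simp
  have "optimal_index_code F_ext (append_cols G (C * G)) \<and> rank_invariant TYPE('a) F F_ext"
    if opt: "optimal_index_code F G"
  proof -
    have rows: "dim_row (append_cols G (C * G)) = dim_row G" by (simp add: append_cols_def)
    \<comment> \<open>A shorter code for the extension would restrict to a code for \<open>F\<close>
      shorter than the optimal \<open>G\<close>.\<close>
    have "dim_row G \<le> dim_row G'" if "index_code F_ext G'" for G' :: "'a mat"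
      using index_code_ext_matrix_restrict[OF assms(1) B] that opt assms(12)
      unfolding optimal_index_code_def by metis
    then have opt': "optimal_index_code F_ext (append_cols G (C * G))"
      using code rows by (simp add: optimal_index_code_def)
    have "optimal_length TYPE('a) F_ext = optimal_length TYPE('a) F"
      using optimal_index_code_length[OF opt] optimal_index_code_length[OF opt'] rows by simp
    then show ?thesis
      using opt' minrk_eq_optimal_length[OF assms(1), where 'a='a] assms(12)
        minrk_eq_optimal_length[OF fitting_matrix_ext_matrix[OF assms(1) B], where 'a='a]
      by (simp add: rank_invariant_def)
  qed
  then show ?thesis using B ext code by blast
qed

end
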